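(* Let $G_{\mathrm{multi}}$ be a finite connected loopless multigraph with positive site and edge energies in which two vertices $a,b$ are joined by a parallel-edge bundle $B_{ab}=\{e_1,\ldots,e_m\}$ (all edges between $a$ and $b$). Let $G_{\mathrm{simple}}$ be obtained by replacing this bundle by a single edge $ab$ of energy $y_{ab}:=\sum_{i=1}^m y_{e_i}$, all other data unchanged. Then for every $\alpha'>0$ $$\mathcal I_{G_{\mathrm{multi}}}^{\mathrm{zono}}(\alpha')=\mathcal I_{G_{\mathrm{simple}}}^{\mathrm{zono}}(\alpha'),$$ and $$\mathcal I_{G_{\mathrm{multi}}}^{\mathrm{corr}}(\alpha')=\frac{\prod_{i=1}^m\frac{\alpha'}{2}B(2\alpha' y_{e_i},2\alpha' y_{e_i})}{\frac{\alpha'}{2}B(2\alpha' y_{ab},2\alpha' y_{ab})}\;\mathcal I_{G_{\mathrm{simple}}}^{\mathrm{corr}}(\alpha').$$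
   Context: $B(\cdot,\cdot)$ is the Euler beta function. For a finite loopless multigraph $G=(V,E)$ with site energies $x_v$ and edge energies $y_e$, $$\mathcal I_G^{\mathrm{zono}}(\alpha')=(\alpha')^{|V|}\int_{\mathbb R^{V}}\prod_{v\in V}\mathrm d\tau_v\prod_{v\in V}(2\cosh\tau_v)^{-\alpha' x_v}\prod_{e=uv\in E}(2\cosh(\tau_u-\tau_v))^{-\alpha' y_e},$$ $$\mathcal I_G^{\square}(\alpha')=(\alpha')^{|E|}\int_{\mathbb R_{>0}^{E}}\prod_{e\in E}\frac{\mathrm dz_e}{z_e}\,(z_e+z_e^{-1})^{-4\alpha' y_e},\qquad \mathcal I_G^{\mathrm{corr}}(\alpha')=\mathcal I_G^{\square}(\alpha')\,\mathcal I_G^{\mathrm{zono}}(\alpha').$$ *)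

theory Defs
  imports "HOL-Analysis.Analysis" "HOL-Library.Uprod"
begin

record ('v, 'e) energy_multigraph =
  verts :: "'v set"
  edges :: "'e set"
  ends :: "'e \<Rightarrow> 'v uprod"
  site_energy :: "'v \<Rightarrow> real"
  edge_energy :: "'e \<Rightarrow> real"

definition finite_loopless :: "('v, 'e) energy_multigraph \<Rightarrow> bool" where
  "finite_loopless G \<longleftrightarrow> finite (verts G) \<and> finite (edges G) \<and>
     (\<forall>e\<in>edges G. set_uprod (ends G e) \<subseteq> verts G \<and> proper_uprod (ends G e))"

definition connected_graph :: "('v, 'e) energy_multigraph \<Rightarrow> bool" where
  "connected_graph G \<longleftrightarrow> verts G \<noteq> {} \<and>
     (\<forall>u\<in>verts G. \<forall>v\<in>verts G. (u, v) \<in> {(s, t). \<exists>e\<in>edges G. ends G e = Upair s t}\<^sup>*)"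

definition positive_energies :: "('v, 'e) energy_multigraph \<Rightarrow> bool" where
  "positive_energies G \<longleftrightarrow>
     (\<forall>v\<in>verts G. 0 < site_energy G v) \<and> (\<forall>e\<in>edges G. 0 < edge_energy G e)"

text \<open>Edges are unordered pairs, so the edge factor is lifted to them; this is possible
  because \<open>cosh\<close> is even.\<close>

lift_definition edge_cosh :: "('v \<Rightarrow> real) \<Rightarrow> 'v uprod \<Rightarrow> real"
  is "\<lambda>\<tau> (u, v). 2 * cosh (\<tau> u - \<tau> v)"
  by (auto simp: eq_upair_def)

lemma edge_cosh_Upair [simp]: "edge_cosh \<tau> (Upair u v) = 2 * cosh (\<tau> u - \<tau> v)"
  by transfer simp

definition zono_integral :: "('v, 'e) energy_multigraph \<Rightarrow> real \<Rightarrow> real" where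
  "zono_integral G \<alpha> = \<alpha> ^ card (verts G) *
     (LINT \<tau>|(\<Pi>\<^sub>M v\<in>verts G. lborel).
        (\<Prod>v\<in>verts G. (2 * cosh (\<tau> v)) powr (- \<alpha> * site_energy G v)) *
        (\<Prod>e\<in>edges G. edge_cosh \<tau> (ends G e) powr (- \<alpha> * edge_energy G e)))"

definition box_integral :: "('v, 'e) energy_multigraph \<Rightarrow> real \<Rightarrow> real" where
  "box_integral G \<alpha> = \<alpha> ^ card (edges G) *
     (LINT z:(\<Pi>\<^sub>E e\<in>edges G. {0<..})|(\<Pi>\<^sub>M e\<in>edges G. lborel).
        (\<Prod>e\<in>edges G. 1 / z e * (z e + inverse (z e)) powr (- 4 * \<alpha> * edge_energy G e)))"

definition corr_integral :: "('v, 'e) energy_multigraph \<Rightarrow> real \<Rightarrow> real" where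
  "corr_integral G \<alpha> = box_integral G \<alpha> * zono_integral G \<alpha>"

definition edge_bundle :: "('v, 'e) energy_multigraph \<Rightarrow> 'v \<Rightarrow> 'v \<Rightarrow> 'e set" where
  "edge_bundle G a b = {e \<in> edges G. ends G e = Upair a b}"

text \<open>The label \<open>f\<close> of the new edge may be any label not used by an edge that is kept;
  it may thus be one of the labels of the bundle.\<close>

definition merge_bundle ::
    "('v, 'e) energy_multigraph \<Rightarrow> 'v \<Rightarrow> 'v \<Rightarrow> 'e \<Rightarrow> ('v, 'e) energy_multigraph" where
  "merge_bundle G a b f = G\<lparr>
     edges := insert f (edges G - edge_bundle G a b),
     ends := (ends G)(f := Upair a b),
     edge_energy := (edge_energy G)(f := (\<Sum>e\<in>edge_bundle G a b. edge_energy G e))\<rparr>"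

end

theory Submission
  imports Defs
begin

text \<open>
  Parallel edges contribute powers of the same hyperbolic cosine to the zonotopal integrand, so
  merging them leaves that integrand unchanged. The box integral factorises over the edges,
  and the substitution \<open>t = z\<^sup>2 / (1 + z\<^sup>2)\<close>, for which
  \<open>t (1 - t) = (z + 1/z)\<^sup>-\<^sup>2\<close> and \<open>dt / (t (1 - t)) = 2 dz / z\<close>,
  turns each factor into a beta integral.
\<close>

lemma Beta_real_pos:
  fixes a b :: real
  assumes "a > 0" "b > 0"
  shows "Beta a b > 0"
  using assms by (simp add: Beta_def Gamma_real_pos)

lemma image_square_over_one_plus_square:
  "(\<lambda>z::real. z\<^sup>2 / (1 + z\<^sup>2)) ` {0<..} = {0<..<1}"
proof (intro equalityI subsetI)
  fix t :: real
  assume "t \<in> (\<lambda>z. z\<^sup>2 / (1 + z\<^sup>2)) ` {0<..}"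
  then obtain z :: real where "z > 0" "t = z\<^sup>2 / (1 + z\<^sup>2)" by auto
  moreover from \<open>z > 0\<close> have "z\<^sup>2 > 0" by simp
  ultimately show "t \<in> {0<..<1}" by (simp add: divide_less_eq_1 add_pos_pos)
next
  fix t :: real
  assume t: "t \<in> {0<..<1}"
  \<comment> \<open>Solving \<open>t = z^2 / (1 + z^2)\<close> for \<open>z^2\<close> gives
    \<open>t / (1 - t)\<close>, which is positive on the open unit interval.\<close>
  define z where "z = sqrt (t / (1 - t))"
  have "z > 0" and z2: "z\<^sup>2 = t / (1 - t)" using t by (auto simp: z_def)
  have sum: "1 + t / (1 - t) = 1 / (1 - t)" using t by (simp add: field_simps)
  have "t = z\<^sup>2 / (1 + z\<^sup>2)" unfolding z2 sum using t by simp
  with \<open>z > 0\<close> show "t \<in> (\<lambda>z. z\<^sup>2 / (1 + z\<^sup>2)) ` {0<..}" by (intro image_eqI[of _ _ z]) simp_all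
qed

lemma absolute_integral_add_inverse_powr_Beta:
  fixes a :: real
  assumes a: "a > 0"
  defines "h \<equiv> \<lambda>z. 1 / z * (z + inverse z) powr (- 2 * a)"
  shows "h absolutely_integrable_on {0<..}" "integral {0<..} h = Beta a a / 2"
proof -
  define g :: "real \<Rightarrow> real" where "g z = z\<^sup>2 / (1 + z\<^sup>2)" for z
  define g' :: "real \<Rightarrow> real" where "g' z = 2 * z / (1 + z\<^sup>2)\<^sup>2" for z
  define f :: "real \<Rightarrow> real" where "f t = t powr (a - 1) * (1 - t) powr (a - 1)" for t
  have nz: "1 + z\<^sup>2 \<noteq> 0" for z :: real
    by (metis add_pos_nonneg zero_less_one zero_le_power2 less_irrefl)
  have der: "(g has_field_derivative g' z) (at z within {0<..})" for z
    unfolding g_def g'_def using nz[of z]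
    by (auto intro!: derivative_eq_intros simp: power2_eq_square field_simps)
  have inj: "inj_on g {0<..}"
  proof (rule inj_onI)
    fix x y assume xy: "x \<in> {0<..}" "y \<in> {0<..}" "g x = g y"
    then have "x\<^sup>2 = y\<^sup>2" using nz[of x] nz[of y] by (simp add: g_def field_simps)
    with xy show "x = y" by simp
  qed
  have img: "g ` {0<..} = {0<..<1}"
    using image_square_over_one_plus_square by (simp add: g_def)
  have "(f has_integral Beta a a) {0<..<1}"
    using has_integral_Beta_real[OF a a] by (simp add: f_def[abs_def] has_integral_Icc_iff_Ioo)
  \<comment> \<open>The change of variables theorem asks for absolute integrability; since
    \<open>f\<close> is nonnegative, this follows from the plain beta integral. The latter is stated
    on the closed interval, and dropping the endpoints does not affect it.\<close>
  moreover have "f t \<ge> 0" for t by (simp add: f_def)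
  ultimately have "f absolutely_integrable_on g ` {0<..} \<and> integral (g ` {0<..}) f = Beta a a"
    unfolding img by (auto simp: absolutely_integrable_on_iff_nonneg has_integral_iff)
  then have sub: "(\<lambda>z. \<bar>g' z\<bar> * f (g z)) absolutely_integrable_on {0<..}"
    "integral {0<..} (\<lambda>z. \<bar>g' z\<bar> * f (g z)) = Beta a a"
    using has_absolute_integral_change_of_variables_1'[OF _ der inj, of f "Beta a a"] by auto
  \<comment> \<open>With \<open>w = z + 1/z\<close> one has \<open>1 + z^2 = z * w\<close>. Hence
    \<open>f (g z)\<close> is \<open>w\<close> to the power \<open>-2 * (a - 1)\<close>, and the
    Jacobian is \<open>2 / (z * w^2)\<close>. The Jacobian's \<open>w^2\<close> cancels the surplus
    \<open>w^2\<close> in \<open>f (g z)\<close>, leaving \<open>2 * h z\<close>.\<close>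
  have h: "h z = (\<bar>g' z\<bar> * f (g z)) / 2" if "z \<in> {0<..}" for z
  proof -
    define w where "w = z + inverse z"
    have z: "z > 0" and w: "w > 0" using that by (auto simp: w_def add_pos_pos)
    have zw: "1 + z\<^sup>2 = z * w" using z by (simp add: w_def power2_eq_square field_simps)
    have one: "1 - g z = 1 / (1 + z\<^sup>2)" using nz[of z] by (simp add: g_def field_simps)
    have "g z * (1 - g z) = w powr (- 2)"
      unfolding one unfolding g_def zw using z w
      by (simp add: powr_minus powr_numeral power2_eq_square field_simps)
    moreover have "f (g z) = (g z * (1 - g z)) powr (a - 1)"
      unfolding one f_def using z by (subst powr_mult) (auto simp: g_def one)
    ultimately have "f (g z) = w powr (- 2 * (a - 1))"
      by (simp only: powr_powr)
    also have "- 2 * (a - 1) = - 2 * a + 2" by simp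
    also have "w powr (- 2 * a + 2) = w powr (- 2 * a) * w\<^sup>2"
      using w by (simp only: powr_add powr_numeral)
    finally have "f (g z) = w powr (- 2 * a) * w\<^sup>2" .
    moreover have "\<bar>g' z\<bar> = 2 / (z * w\<^sup>2)"
      unfolding g'_def zw using z w by (simp add: power2_eq_square field_simps)
    moreover have "h z = 1 / z * w powr (- 2 * a)" by (simp only: h_def w_def)
    ultimately have "h z = 1 / z * w powr (- 2 * a)"
      "\<bar>g' z\<bar> * f (g z) = 2 / (z * w\<^sup>2) * (w powr (- 2 * a) * w\<^sup>2)"
      by (simp_all only:)
    then show ?thesis using z w by simp
  qed
  have half: "(\<lambda>z. (\<bar>g' z\<bar> * f (g z)) / 2) absolutely_integrable_on {0<..}"
    using set_integrable_divide[of 2, OF sub(1)] by simp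
  show "h absolutely_integrable_on {0<..}"
    using half by (subst set_integrable_cong[OF refl refl h])
  have "integral {0<..} h = integral {0<..} (\<lambda>z. (\<bar>g' z\<bar> * f (g z)) / 2)"
    by (rule integral_cong) (rule h)
  with sub(2) show "integral {0<..} h = Beta a a / 2" by simp
qed

text \<open>Carries the previous result from the Lebesgue measure to \<open>lborel\<close>, the
  measure on each coordinate in \<open>box_integral\<close>.\<close>

lemma lborel_integral_add_inverse_powr_Beta:
  fixes a :: real
  assumes a: "a > 0"
  defines "h \<equiv> \<lambda>z. 1 / z * (z + inverse z) powr (- 2 * a)"
  shows "set_integrable lborel {0<..} h" "(LINT z:{0<..}|lborel. h z) = Beta a a / 2"
proof -
  have "h absolutely_integrable_on {0<..}"
    unfolding h_def by (rule absolute_integral_add_inverse_powr_Beta[OF a])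
  then show int: "set_integrable lborel {0<..} h"
    \<comment> \<open>The Lebesgue measure is the completion of \<open>lborel\<close>, and for a
      Borel measurable integrand such as \<open>h\<close> cut off to the half-line, integrability
      with respect to the two agrees.\<close>
    unfolding set_integrable_def
    by (subst (asm) integrable_completion) (auto simp: h_def)
  show "(LINT z:{0<..}|lborel. h z) = Beta a a / 2"
    using set_borel_integral_eq_integral(2)[OF int] absolute_integral_add_inverse_powr_Beta(2)[OF a]
    by (simp add: h_def)
qed

text \<open>The indicator of a box is the product of the indicators of its sides, so the integrand
  including the indicator is still a product of functions of one coordinate each, and Fubini
  applies.\<close>

lemma set_integral_PiM_prod:
  fixes f :: "'i \<Rightarrow> real \<Rightarrow> real"
  assumes "finite I" "\<And>i. i \<in> I \<Longrightarrow> set_integrable lborel (A i) (f i)"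
  shows "(LINT x:(\<Pi>\<^sub>E i\<in>I. A i)|(\<Pi>\<^sub>M i\<in>I. lborel). (\<Prod>i\<in>I. f i (x i))) =
    (\<Prod>i\<in>I. LINT x:A i|lborel. f i x)"
proof -
  interpret product_sigma_finite "\<lambda>i::'i. lborel :: real measure" ..
  \<comment> \<open>The restriction to the space of the product measure matters: its points are
    extensional, so a point outside the box must have some coordinate \<open>i\<close> in
    \<open>I\<close> outside \<open>A i\<close>. That coordinate makes the right-hand product
    vanish.\<close>
  have eq: "indicator (\<Pi>\<^sub>E i\<in>I. A i) x *\<^sub>R (\<Prod>i\<in>I. f i (x i)) =
      (\<Prod>i\<in>I. indicator (A i) (x i) *\<^sub>R f i (x i))"
    if x: "x \<in> space (\<Pi>\<^sub>M i\<in>I. lborel)" for x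
  proof (cases "x \<in> (\<Pi>\<^sub>E i\<in>I. A i)")
    case True
    then show ?thesis by (auto simp: PiE_iff intro!: prod.cong)
  next
    case False
    then obtain i where "i \<in> I" "x i \<notin> A i"
      using x by (auto simp: space_PiM PiE_iff)
    with \<open>finite I\<close> have "(\<Prod>i\<in>I. indicator (A i) (x i) *\<^sub>R f i (x i)) = 0"
      by (intro prod_zero bexI[of _ i]) auto
    then show ?thesis using False by (metis indicator_simps(2) scaleR_zero_left)
  qed
  have "(LINT x:(\<Pi>\<^sub>E i\<in>I. A i)|(\<Pi>\<^sub>M i\<in>I. lborel). (\<Prod>i\<in>I. f i (x i))) =
      (LINT x|(\<Pi>\<^sub>M i\<in>I. lborel). (\<Prod>i\<in>I. indicator (A i) (x i) *\<^sub>R f i (x i)))"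
    unfolding set_lebesgue_integral_def by (rule Bochner_Integration.integral_cong[OF refl]) (rule eq)
  also have "\<dots> = (\<Prod>i\<in>I. LINT x:A i|lborel. f i x)"
    using product_integral_prod[of I "\<lambda>i x. indicator (A i) x *\<^sub>R f i x"] assms
    unfolding set_lebesgue_integral_def set_integrable_def by blast
  finally show ?thesis .
qed

text \<open>The exponent \<open>4 * \<alpha> * y\<close> is \<open>2 * a\<close> for
  \<open>a = 2 * \<alpha> * y\<close>, which fixes the arguments of the beta function. The prefactor
  supplies one \<open>\<alpha>\<close> per edge, and the 1/2 comes from the substitution.\<close>

lemma box_integral_eq_prod_Beta:
  assumes "finite (edges G)" "\<And>e. e \<in> edges G \<Longrightarrow> edge_energy G e > 0" "\<alpha> > 0"
  shows "box_integral G \<alpha> =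
    (\<Prod>e\<in>edges G. \<alpha> / 2 * Beta (2 * \<alpha> * edge_energy G e) (2 * \<alpha> * edge_energy G e))"
proof -
  define h where "h e z = 1 / z * (z + inverse z) powr (- 4 * \<alpha> * edge_energy G e)"
    for e and z :: real
  have h: "set_integrable lborel {0<..} (h e)"
    "(LINT z:{0<..}|lborel. h e z) =
      Beta (2 * \<alpha> * edge_energy G e) (2 * \<alpha> * edge_energy G e) / 2"
    if "e \<in> edges G" for e
    using lborel_integral_add_inverse_powr_Beta[of "2 * \<alpha> * edge_energy G e"] assms that
    by (simp_all add: h_def[abs_def] mult.assoc)
  have "box_integral G \<alpha> = \<alpha> ^ card (edges G) * (\<Prod>e\<in>edges G. LINT z:{0<..}|lborel. h e z)"
    unfolding box_integral_def h_def[symmetric]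
    by (subst set_integral_PiM_prod) (use assms h in auto)
  also have "\<dots> = (\<Prod>e\<in>edges G. \<alpha> * (LINT z:{0<..}|lborel. h e z))"
    by (simp add: prod.distrib)
  finally show ?thesis
    by (simp add: h(2))
qed

lemma edge_cosh_pos: "edge_cosh \<tau> p > 0"
  by (cases p) simp

text \<open>The label \<open>f\<close> may come from the bundle but belongs to no kept edge, so
  updating the data at \<open>f\<close> leaves every kept factor alone and the new edge contributes
  exactly one further factor. \<open>F\<close> is generic because the lemma serves both the
  hyperbolic factors and the beta factors.\<close>

lemma prod_edges_merge_bundle:
  fixes F :: "'v uprod \<Rightarrow> real \<Rightarrow> 'c :: comm_monoid_mult"
  assumes "finite (edges G)" "f \<notin> edges G - edge_bundle G a b"
  defines "H \<equiv> merge_bundle G a b f"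
  shows "(\<Prod>e\<in>edges H. F (ends H e) (edge_energy H e)) =
    F (Upair a b) (\<Sum>e\<in>edge_bundle G a b. edge_energy G e) *
      (\<Prod>e\<in>edges G - edge_bundle G a b. F (ends G e) (edge_energy G e))"
proof -
  have "(\<Prod>e\<in>edges G - edge_bundle G a b. F (ends H e) (edge_energy H e)) =
      (\<Prod>e\<in>edges G - edge_bundle G a b. F (ends G e) (edge_energy G e))"
    using assms(2) by (intro prod.cong) (auto simp: H_def merge_bundle_def)
  with assms(1,2) show ?thesis
    by (simp add: H_def merge_bundle_def)
qed

lemma prod_edges_bundle:
  assumes "finite (edges G)"
  shows "(\<Prod>e\<in>edges G. F e) =
    (\<Prod>e\<in>edge_bundle G a b. F e) * (\<Prod>e\<in>edges G - edge_bundle G a b. F e)"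
  using prod.subset_diff[of "edge_bundle G a b" "edges G" F] assms
  by (auto simp: edge_bundle_def mult.commute)

text \<open>The integrands agree at every point: all bundle edges share the positive base
  \<open>edge_cosh \<tau> (Upair a b)\<close>, so the product of their powers is one power with the
  summed exponent.\<close>

lemma zono_integral_merge_bundle:
  assumes "finite (edges G)" "f \<notin> edges G - edge_bundle G a b"
  shows "zono_integral (merge_bundle G a b f) \<alpha> = zono_integral G \<alpha>"
proof -
  let ?H = "merge_bundle G a b f"
  have "(\<Prod>e\<in>edges ?H. edge_cosh \<tau> (ends ?H e) powr (- \<alpha> * edge_energy ?H e)) =
      (\<Prod>e\<in>edges G. edge_cosh \<tau> (ends G e) powr (- \<alpha> * edge_energy G e))" for \<tau>
  proof -
    have "(\<Prod>e\<in>edge_bundle G a b. edge_cosh \<tau> (ends G e) powr (- \<alpha> * edge_energy G e)) =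
        (\<Prod>e\<in>edge_bundle G a b. edge_cosh \<tau> (Upair a b) powr (- \<alpha> * edge_energy G e))"
      by (intro prod.cong) (auto simp: edge_bundle_def)
    also have "\<dots> = edge_cosh \<tau> (Upair a b) powr
        (- \<alpha> * (\<Sum>e\<in>edge_bundle G a b. edge_energy G e))"
      using edge_cosh_pos[of \<tau> "Upair a b"]
      by (simp add: powr_sum sum_distrib_left del: edge_cosh_Upair flip: sum_negf)
    finally show ?thesis
      unfolding prod_edges_bundle[OF assms(1), of _ a b]
        prod_edges_merge_bundle[OF assms, of "\<lambda>p y. edge_cosh \<tau> p powr (- \<alpha> * y)"]
      by (simp only:)
  qed
  moreover have "verts ?H = verts G" "site_energy ?H = site_energy G"
    by (simp_all add: merge_bundle_def)
  ultimately show ?thesis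
    by (simp add: zono_integral_def)
qed

theorem mainTheorem6:
  fixes G_multi G_simple :: "('v, 'e) energy_multigraph"
    and a b :: 'v and f :: 'e and \<alpha> y_ab :: real
  assumes "finite_loopless G_multi"
    and "connected_graph G_multi"
    and "positive_energies G_multi"
    and "a \<in> verts G_multi" and "b \<in> verts G_multi" and "a \<noteq> b"
    and "edge_bundle G_multi a b \<noteq> {}"
    and "f \<notin> edges G_multi - edge_bundle G_multi a b"
    and "G_simple = merge_bundle G_multi a b f"
    and "y_ab = (\<Sum>e\<in>edge_bundle G_multi a b. edge_energy G_multi e)"
    and "\<alpha> > 0"
  shows "zono_integral G_multi \<alpha> = zono_integral G_simple \<alpha> \<and>
    corr_integral G_multi \<alpha> =
      (\<Prod>e\<in>edge_bundle G_multi a b.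
          \<alpha> / 2 * Beta (2 * \<alpha> * edge_energy G_multi e) (2 * \<alpha> * edge_energy G_multi e)) /
      (\<alpha> / 2 * Beta (2 * \<alpha> * y_ab) (2 * \<alpha> * y_ab)) *
      corr_integral G_simple \<alpha>"
proof -
  \<comment> \<open>\<open>c y\<close> is the factor that an edge of energy \<open>y\<close>
    contributes to the box integral; \<open>R\<close> collects the kept edges and is common to both
    graphs.\<close>
  define c where "c y = \<alpha> / 2 * Beta (2 * \<alpha> * y) (2 * \<alpha> * y)" for y
  define R where "R = (\<Prod>e\<in>edges G_multi - edge_bundle G_multi a b. c (edge_energy G_multi e))"
  have fin: "finite (edges G_multi)"
    using \<open>finite_loopless G_multi\<close> by (simp add: finite_loopless_def)
  have pos: "\<And>e. e \<in> edges G_multi \<Longrightarrow> edge_energy G_multi e > 0"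
    using \<open>positive_energies G_multi\<close> by (simp add: positive_energies_def)
  note f = \<open>f \<notin> edges G_multi - edge_bundle G_multi a b\<close>
  note simple = \<open>G_simple = merge_bundle G_multi a b f\<close>
  note y_ab = \<open>y_ab = (\<Sum>e\<in>edge_bundle G_multi a b. edge_energy G_multi e)\<close>
  have zono: "zono_integral G_multi \<alpha> = zono_integral G_simple \<alpha>"
    unfolding simple by (rule zono_integral_merge_bundle[OF fin f, symmetric])
  have sub: "edge_bundle G_multi a b \<subseteq> edges G_multi"
    by (auto simp: edge_bundle_def)
  \<comment> \<open>As a nonempty sum of positive energies. This makes the beta factor in the
    denominator nonzero and gives the merged edge a positive energy, so that the box formula applies
    to \<open>G_simple\<close> too.\<close>
  have "y_ab > 0"
    unfolding y_ab using sub fin pos \<open>edge_bundle G_multi a b \<noteq> {}\<close>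
    by (intro sum_pos) (auto intro: finite_subset)
  then have c_nz: "c y_ab \<noteq> 0"
    using Beta_real_pos[of "2 * \<alpha> * y_ab" "2 * \<alpha> * y_ab"] \<open>\<alpha> > 0\<close> by (simp add: c_def)
  have multi_box: "box_integral G_multi \<alpha> =
      (\<Prod>e\<in>edge_bundle G_multi a b. c (edge_energy G_multi e)) * R"
    using box_integral_eq_prod_Beta[OF fin pos \<open>\<alpha> > 0\<close>] prod_edges_bundle[OF fin, of _ a b]
    by (simp add: c_def R_def)
  have "finite (edges G_simple)" "\<And>e. e \<in> edges G_simple \<Longrightarrow> edge_energy G_simple e > 0"
    using fin pos \<open>y_ab > 0\<close> by (auto simp: simple merge_bundle_def y_ab split: if_splits)
  then have "box_integral G_simple \<alpha> = (\<Prod>e\<in>edges G_simple. c (edge_energy G_simple e))"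
    using \<open>\<alpha> > 0\<close> by (simp add: box_integral_eq_prod_Beta c_def)
  also have "\<dots> = c y_ab * R"
    using prod_edges_merge_bundle[OF fin f, of "\<lambda>_. c"] by (simp add: simple y_ab R_def)
  \<comment> \<open>The two box integrals differ only in the bundle product against
    \<open>c y_ab\<close>, and the zonotopal factors are equal, so dividing by the nonzero
    \<open>c y_ab\<close> gives the ratio.\<close>
  finally have "corr_integral G_multi \<alpha> =
      (\<Prod>e\<in>edge_bundle G_multi a b. c (edge_energy G_multi e)) / c y_ab * corr_integral G_simple \<alpha>"
    using c_nz zono multi_box by (simp add: corr_integral_def)
  with zono show ?thesis
    by (simp add: c_def)
qed

end
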